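(* Let $G$ be a graph. If $S$ is a general position set of $\mathcal{M}(G)$ that does not contain the root $u^*$, then the partition $\pi(S)=(V_1,V_2,V_3,V_4)$ of $V(G)$ given by $V_1=\{u\in V(G): u,u'\in S\}$, $V_2=\{u\in V(G): u\notin S,\ u'\in S\}$, $V_3=\{u\in V(G): u\in S,\ u'\notin S\}$, $V_4=\{u\in V(G): u,u'\notin S\}$ is an $\mathcal{MGP}$-partition of $G$.
   Context: All graphs are simple, connected and finite. $d_G$ is the graph distance. A set $S$ of vertices of a graph $H$ is a general position set if no shortest path in $H$ contains three or more vertices of $S$. The Mycielskian $\mathcal{M}(G)$ of a graph $G$ with vertex set $V$ and edge set $E$ has vertex set $V\cup V'\cup\{u^*\}$, where $V'=\{u' : u\in V\}$ is a disjoint copy of $V$ and $u^*$ is an additional vertex (the root), and edge set $E\cup\{uv' : uv\in E\}\cup\{v'u^* : v'\in V'\}$ (for each edge $uv\in E$ both $uv'$ and $vu'$ are included). A partition $\pi=(V_1,V_2,V_3,V_4)$ of $V(G)$ into four (possibly empty) sets is an $\mathcal{MGP}$-partition if and only if it satisfies the following three conditions: (1) if $e$ is an edge in the subgraph induced by $V_1\cup V_3$, then $e$ has both endpoints in $V_3$; (2) if a vertex $u\in V_1\cup V_3$ has a neighbour $v\in V_2$, then $d_G(u,w)=2$ for all $w\in (V_1\cup V_2)\setminus\{u,v\}$ and $d_G(u,w)\leq 3$ for all $w\in V_3\setminus\{u\}$; (3) if $P$ is a shortest path $u_0,u_1,\dots,u_\ell$ with length $\ell\leq 4$ in $G$ that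 passes through three or more vertices of $V_1\cup V_2\cup V_3$, then either $u_0,u_\ell\in V_2$ and $\ell\geq 3$, or else $P$ or its reverse path has one of the following forms: (a) $u_0,u_1,u_2$, where $u_0,u_1\in V_2$; (b) $u_0,u_1,u_2,u_3$, where $u_0,u_1\in V_2$, $u_2\notin V_1\cup V_2\cup V_3$ and $u_3\in V_1\cup V_3$; or (c) $u_0,u_1,u_2,u_3,u_4$, where $u_0\in V_2$, $u_3\notin V_1\cup V_2$ and $u_4\in V_1\cup V_3$.
   Formalization: Condition (3) is required only for shortest paths P whose two end vertices both lie in V_1∪V_2∪V_3; as literally stated the lemma fails for the path a-b-c-d with S={b',c',d'}. *)

theory Defs
  imports "Graph_Theory.Graph_Theory"
begin

text \<open>
  A finite simple graph is a \<open>pair_graph\<close>: each undirected edge is the pair of its two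
  opposite arcs. Graph distance is the library's \<open>\<mu>\<close> with unit arc costs, so it is
  \<open>\<infinity>\<close> between different components.
\<close>

definition gdist :: "'a pair_pre_digraph \<Rightarrow> 'a \<Rightarrow> 'a \<Rightarrow> ereal" where
  "gdist G u v = wf_digraph.\<mu> (with_proj G) (\<lambda>_. 1) u v"

definition shortest_path :: "'a pair_pre_digraph \<Rightarrow> 'a list \<Rightarrow> bool" where
  "shortest_path G p \<longleftrightarrow>
     vpath p (with_proj G) \<and> ereal (real (vwalk_length p)) = gdist G (hd p) (last p)"

definition general_position_set :: "'a pair_pre_digraph \<Rightarrow> 'a set \<Rightarrow> bool" where
  "general_position_set G S \<longleftrightarrow>
     S \<subseteq> pverts G \<and> (\<forall>p. shortest_path G p \<longrightarrow> \<not> 3 \<le> card (set p \<inter> S))"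

datatype 'a mvertex = Orig 'a | Copy 'a | Root

definition mycielskian :: "'a pair_pre_digraph \<Rightarrow> 'a mvertex pair_pre_digraph" where
  "mycielskian G = \<lparr>
     pverts = Orig ` pverts G \<union> Copy ` pverts G \<union> {Root},
     parcs = {(Orig u, Orig v) | u v. (u, v) \<in> parcs G}
           \<union> {(Orig u, Copy v) | u v. (u, v) \<in> parcs G}
           \<union> {(Copy u, Orig v) | u v. (u, v) \<in> parcs G}
           \<union> {(Copy v, Root) | v. v \<in> pverts G}
           \<union> {(Root, Copy v) | v. v \<in> pverts G} \<rparr>"

lemma (in pair_graph) pair_graph_mycielskian: "pair_graph (mycielskian G)"
proof
  have "parcs (mycielskian G) \<subseteq> pverts (mycielskian G) \<times> pverts (mycielskian G)"
    by (auto simp: mycielskian_def dest: in_arcsD1 in_arcsD2)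
  moreover show "finite (pverts (mycielskian G))"
    by (simp add: mycielskian_def pair_finite_verts)
  ultimately show "finite (parcs (mycielskian G))"
    by (meson finite_SigmaI finite_subset)
  show "symmetric (with_proj (mycielskian G))"
    by (auto simp: symmetric_def sym_def mycielskian_def dest: arcs_symmetric)
qed (auto simp: mycielskian_def dest: in_arcsD1 in_arcsD2 no_loops')

definition MGP1 :: "'a pair_pre_digraph \<Rightarrow> 'a set \<Rightarrow> 'a set \<Rightarrow> bool" where
  "MGP1 G V1 V3 \<longleftrightarrow>
     (\<forall>e \<in> arcs (with_proj G \<restriction> (V1 \<union> V3)). fst e \<in> V3 \<and> snd e \<in> V3)"

definition MGP2 :: "'a pair_pre_digraph \<Rightarrow> 'a set \<Rightarrow> 'a set \<Rightarrow> 'a set \<Rightarrow> bool" where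
  "MGP2 G V1 V2 V3 \<longleftrightarrow>
     (\<forall>u \<in> V1 \<union> V3. \<forall>v \<in> V2. (u, v) \<in> parcs G \<longrightarrow>
        (\<forall>w \<in> (V1 \<union> V2) - {u, v}. gdist G u w = 2) \<and>
        (\<forall>w \<in> V3 - {u}. gdist G u w \<le> 3))"

definition MGP_form :: "'a set \<Rightarrow> 'a set \<Rightarrow> 'a set \<Rightarrow> 'a list \<Rightarrow> bool" where
  "MGP_form V1 V2 V3 p \<longleftrightarrow>
     (\<exists>u0 u1 u2. p = [u0, u1, u2] \<and> u0 \<in> V2 \<and> u1 \<in> V2) \<or>
     (\<exists>u0 u1 u2 u3. p = [u0, u1, u2, u3] \<and> u0 \<in> V2 \<and> u1 \<in> V2 \<and>
        u2 \<notin> V1 \<union> V2 \<union> V3 \<and> u3 \<in> V1 \<union> V3) \<or>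
     (\<exists>u0 u1 u2 u3 u4. p = [u0, u1, u2, u3, u4] \<and> u0 \<in> V2 \<and>
        u3 \<notin> V1 \<union> V2 \<and> u4 \<in> V1 \<union> V3)"

text \<open>
  The third condition ranges over shortest paths whose two ends are themselves among the
  counted vertices of \<open>V1 \<union> V2 \<union> V3\<close>. Every listed exception has its ends there;
  without this restriction the condition would also forbid extending an allowed path by a
  vertex of \<open>V4\<close>. For example, on the path graph \<open>a - b - c - d\<close> the copies of \<open>b\<close>, \<open>c\<close>, \<open>d\<close>
  are in general position in the Mycielskian and give \<open>V2 = {b, c, d}\<close> and \<open>V4 = {a}\<close>, but the
  shortest path \<open>a, b, c, d\<close> is not among the exceptions.
\<close>

definition MGP3 :: "'a pair_pre_digraph \<Rightarrow> 'a set \<Rightarrow> 'a set \<Rightarrow> 'a set \<Rightarrow> bool" where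
  "MGP3 G V1 V2 V3 \<longleftrightarrow>
     (\<forall>p. shortest_path G p \<and> vwalk_length p \<le> 4 \<and>
          hd p \<in> V1 \<union> V2 \<union> V3 \<and> last p \<in> V1 \<union> V2 \<union> V3 \<and>
          3 \<le> card (set p \<inter> (V1 \<union> V2 \<union> V3)) \<longrightarrow>
        (hd p \<in> V2 \<and> last p \<in> V2 \<and> 3 \<le> vwalk_length p) \<or>
        MGP_form V1 V2 V3 p \<or> MGP_form V1 V2 V3 (rev p))"

definition MGP_partition ::
    "'a pair_pre_digraph \<Rightarrow> 'a set \<Rightarrow> 'a set \<Rightarrow> 'a set \<Rightarrow> 'a set \<Rightarrow> bool" where
  "MGP_partition G V1 V2 V3 V4 \<longleftrightarrow>
     V1 \<union> V2 \<union> V3 \<union> V4 = pverts G \<and>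
     V1 \<inter> V2 = {} \<and> V1 \<inter> V3 = {} \<and> V1 \<inter> V4 = {} \<and>
     V2 \<inter> V3 = {} \<and> V2 \<inter> V4 = {} \<and> V3 \<inter> V4 = {} \<and>
     MGP1 G V1 V3 \<and> MGP2 G V1 V2 V3 \<and> MGP3 G V1 V2 V3"

end

theory Submission
  imports Defs
begin

text \<open>
  Distances in the Mycielskian are those of \<open>G\<close> with a cap, because the root offers shortcuts:
  a detour over the root takes four steps between two original vertices, three between an
  original vertex and a copy, and two between two copies. Hence a shortest path of length at most
  four in \<open>G\<close> stays shortest in the Mycielskian when some of its vertices, no two of them
  consecutive, are replaced by their copies; one end may be replaced if the length is at most
  three (\<open>shortest_path_mlift\<close>), and both ends if it is two (\<open>no_copy_orig_copy\<close>). Conversely, when the distance in \<open>G\<close> reaches the cap, the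
  detour over the root is itself a shortest path (\<open>shortest_path_via_root_to_copy\<close>,
  \<open>shortest_path_via_root_to_orig\<close>). The lower bounds on distances behind both facts come from
  one potential function (\<open>gdist_mycielskian_ge\<close>).

  Every violation of one of the three conditions then yields a shortest path of the Mycielskian
  through three vertices of \<open>S\<close>. For the first condition this is the path \<open>u, v, u'\<close>. For the second it is
  \<open>w', u, v'\<close>, or a path that leaves \<open>u\<close> through \<open>v'\<close> and the root. For the third, take both
  ends and one counted interior vertex of the given path of \<open>G\<close>, and replace those of the three
  that only have their copy in \<open>S\<close>. This fails to give a shortest path only if two replaced vertices
  are consecutive, or if the path is too long for its replaced ends. The exceptional forms of the
  condition are what remains, after one further detour over the root that excludes \<open>u\<^sub>3\<close> from
  \<open>V\<^sub>1 \<union> V\<^sub>2\<close> on paths of length four.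
\<close>

section \<open>Distances and shortest paths in finite graphs\<close>

lemma (in pair_wf_digraph) awalk_cost_unit: "awalk_cost (\<lambda>_. 1) p = real (length p)"
  by (induction p) auto

lemma (in pair_wf_digraph) awalk_vwalk_arcs:
  assumes "vwalk p (with_proj G)"
  shows "awalk (hd p) (vwalk_arcs p) (last p)"
  using assms by (induction p rule: vwalk_arcs.induct) (auto simp: awalk_simps)

lemma (in pair_wf_digraph) gdist_le_length:
  assumes "vwalk p (with_proj G)"
  shows "gdist G (hd p) (last p) \<le> ereal (real (length p - 1))"
  using min_cost_le_walk_cost[OF awalk_vwalk_arcs[OF assms], of "\<lambda>_. 1"]
  by (simp add: gdist_def awalk_cost_unit flip: vwalk_length_def)

lemma (in pair_wf_digraph) gdist_greatest:
  assumes "\<And>p. awalk u p v \<Longrightarrow> c \<le> ereal (real (length p))"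
  shows "c \<le> gdist G u v"
  unfolding gdist_def \<mu>_def using assms by (auto intro!: INF_greatest simp: awalk_cost_unit)

lemma (in pair_wf_digraph) gdist_nonneg: "0 \<le> gdist G u v"
  by (rule gdist_greatest) simp

lemma (in pair_wf_digraph) gdist_self:
  assumes "u \<in> pverts G"
  shows "gdist G u u = 0"
  using gdist_le_length[of "[u]"] gdist_nonneg[of u u] assms by (simp add: zero_ereal_def)

text \<open>
  Distances are natural numbers or infinite. In this form, integrality turns the failure of an
  upper bound on a distance into the next lower bound.
\<close>
lemma (in pair_wf_digraph) Suc_le_gdist:
  assumes "ereal (real n) < gdist G u v"
  shows "ereal (real (Suc n)) \<le> gdist G u v"
proof (rule gdist_greatest)
  fix p assume "awalk u p v"
  then have "gdist G u v \<le> ereal (real (length p))"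
    using min_cost_le_walk_cost[of u p v "\<lambda>_. 1"] by (simp add: gdist_def awalk_cost_unit)
  with assms have "ereal (real n) < ereal (real (length p))"
    by (rule less_le_trans)
  then show "ereal (real (Suc n)) \<le> ereal (real (length p))"
    by simp
qed

text \<open>
  A function that starts at \<open>0\<close> in \<open>u\<close> and grows by at most one along each arc cannot exceed the
  length of any walk from \<open>u\<close>. This bounds a distance from below without any analysis of the
  possible walks.
\<close>
lemma (in pair_wf_digraph) potential_le_gdist:
  assumes "\<And>x y. (x, y) \<in> parcs G \<Longrightarrow> f y \<le> f x + (1 :: ereal)"
    and "f u = 0"
  shows "f v \<le> gdist G u v"
proof (rule gdist_greatest)
  fix p assume "awalk u p v"
  then have "f v \<le> f u + ereal (real (length p))"
  proof (induction p arbitrary: u)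
    case Nil
    then show ?case by (simp add: awalk_Nil_iff flip: zero_ereal_def)
  next
    case (Cons e p)
    then have e: "(u, snd e) \<in> parcs G" and "awalk (snd e) p v"
      by (auto simp: awalk_Cons_iff)
    then have "f v \<le> f (snd e) + ereal (real (length p))"
      by (simp add: Cons.IH)
    also have "\<dots> \<le> (f u + 1) + ereal (real (length p))"
      by (intro add_right_mono assms e)
    finally show ?case
      by (simp add: add.assoc one_ereal_def)
  qed
  then show "f v \<le> ereal (real (length p))"
    by (simp add: assms)
qed

lemma (in pair_wf_digraph) one_le_gdist:
  assumes "u \<noteq> v"
  shows "1 \<le> gdist G u v"
  using potential_le_gdist[of "\<lambda>x. if x = u then 0 else 1" u v] assms
  by (auto simp: zero_ereal_def one_ereal_def split: if_splits)

lemma (in pair_wf_digraph) two_le_gdist: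
  assumes "u \<noteq> v" "(u, v) \<notin> parcs G"
  shows "2 \<le> gdist G u v"
proof -
  let ?f = "\<lambda>x. ereal (if x = u then 0 else if (u, x) \<in> parcs G then 1 else 2)"
  have "?f v \<le> gdist G u v"
    by (rule potential_le_gdist) (auto simp: one_ereal_def)
  then show ?thesis
    using assms by simp
qed

lemma (in pair_fin_digraph) gdist_arc_le:
  assumes "(x, y) \<in> parcs G"
  shows "gdist G u y \<le> gdist G u x + 1"
  using pos_cost_mu_triangle[of "\<lambda>_. 1" "(x, y)" x y u] assms
  by (simp add: gdist_def arc_to_ends_def one_ereal_def)

lemma (in pair_sym_digraph) gdist_sym: "gdist G u v = gdist G v u"
proof -
  have "gdist G u v \<le> gdist G v u" for u v
  proof (rule gdist_greatest)
    fix p assume "awalk v p u"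
    then have "awalk u (rev_path p) v" by simp
    moreover have "length (rev_path p) = length p"
      by (induction p) auto
    ultimately show "gdist G u v \<le> ereal (real (length p))"
      using min_cost_le_walk_cost[of u "rev_path p" v "\<lambda>_. 1"]
      by (simp add: gdist_def awalk_cost_unit)
  qed
  then show ?thesis by (intro antisym)
qed

lemma (in pair_wf_digraph) shortest_pathI:
  assumes "vwalk p (with_proj G)" "distinct p"
    and "ereal (real (length p - 1)) \<le> gdist G (hd p) (last p)"
  shows "shortest_path G p"
  using gdist_le_length[OF assms(1)] assms by (auto simp: shortest_path_def)

lemma (in pair_sym_digraph) shortest_path_rev:
  assumes "shortest_path G p"
  shows "shortest_path G (rev p)"
proof -
  have "vwalk p (with_proj G)" "p \<noteq> []"
    using assms by (auto simp: shortest_path_def)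
  then have "vwalk (rev p) (with_proj G)"
    by (auto simp: vwalk_def set_vwalk_arcs_rev arcs_symmetric)
  then show ?thesis
    using assms \<open>p \<noteq> []\<close>
    by (auto simp: shortest_path_def vpath_def hd_rev last_rev gdist_sym[of "last p"])
qed

lemma (in pair_wf_digraph) shortest_path_induced_P3:
  assumes "(x, y) \<in> parcs G" "(y, z) \<in> parcs G" "(x, z) \<notin> parcs G" "x \<noteq> y" "y \<noteq> z" "x \<noteq> z"
  shows "shortest_path G [x, y, z]"
proof (rule shortest_pathI)
  show "vwalk [x, y, z] (with_proj G)"
    using assms by (auto dest: in_arcsD2)
  show "ereal (real (length [x, y, z] - 1)) \<le> gdist G (hd [x, y, z]) (last [x, y, z])"
    using two_le_gdist[of x z] assms by simp
qed (use assms in auto)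

lemma (in pair_wf_digraph) general_position_no_three:
  assumes "general_position_set G S" "shortest_path G p"
    and "{x, y, z} \<subseteq> set p \<inter> S" "x \<noteq> y" "x \<noteq> z" "y \<noteq> z"
  shows False
proof -
  have "card {x, y, z} \<le> card (set p \<inter> S)"
    by (intro card_mono assms) simp
  then show False
    using assms by (auto simp: general_position_set_def)
qed

text \<open>
  Connectedness enters here: a detour over the root can end in an original vertex only if that
  vertex has a neighbour whose copy can be used.
\<close>
lemma (in pair_graph) neighbour_if_connected:
  assumes "Digraph_Component.connected (with_proj G)"
    and "u \<in> pverts G" "w \<in> pverts G" "u \<noteq> w"
  obtains x where "(x, w) \<in> parcs G"
proof -
  have "strongly_connected (with_proj G)"
    using symmetric_connected_imp_strongly_connected assms(1) pair_sym_arcs by blast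
  then have "u \<rightarrow>\<^sup>*\<^bsub>with_proj G\<^esub> w"
    using assms by (auto simp: strongly_connected_def)
  then obtain p where "awalk u p w"
    by (auto simp: reachable_awalk)
  then have "u = w \<or> (\<exists>x. (x, w) \<in> parcs G)"
  proof (induction p arbitrary: u)
    case (Cons e p)
    then have "(u, snd e) \<in> parcs G" "snd e = w \<or> (\<exists>x. (x, w) \<in> parcs G)"
      by (auto simp: awalk_Cons_iff)
    then show ?case by blast
  qed (simp add: awalk_Nil_iff)
  with assms that show thesis by blast
qed

section \<open>Shortest paths in the Mycielskian\<close>

lemma pverts_mycielskian [simp]:
  "Orig v \<in> pverts (mycielskian G) \<longleftrightarrow> v \<in> pverts G"
  "Copy v \<in> pverts (mycielskian G) \<longleftrightarrow> v \<in> pverts G"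
  "Root \<in> pverts (mycielskian G)"
  by (auto simp: mycielskian_def)

lemma parcs_mycielskian [simp]:
  "(Orig u, Orig v) \<in> parcs (mycielskian G) \<longleftrightarrow> (u, v) \<in> parcs G"
  "(Orig u, Copy v) \<in> parcs (mycielskian G) \<longleftrightarrow> (u, v) \<in> parcs G"
  "(Copy u, Orig v) \<in> parcs (mycielskian G) \<longleftrightarrow> (u, v) \<in> parcs G"
  "(Copy u, Copy v) \<notin> parcs (mycielskian G)"
  "(Orig u, Root) \<notin> parcs (mycielskian G)"
  "(Root, Orig u) \<notin> parcs (mycielskian G)"
  "(Copy u, Root) \<in> parcs (mycielskian G) \<longleftrightarrow> u \<in> pverts G"
  "(Root, Copy u) \<in> parcs (mycielskian G) \<longleftrightarrow> u \<in> pverts G"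
  "(Root, Root) \<notin> parcs (mycielskian G)"
  by (auto simp: mycielskian_def)

context pair_graph
begin

interpretation M: pair_graph "mycielskian G"
  by (rule pair_graph_mycielskian)

text \<open>
  If \<open>G\<close> is connected with more than one vertex, the potential is the exact distance from
  \<open>Orig u\<close>: the caps
  \<open>4\<close> and \<open>3\<close> are the lengths of the detours over the root, and the copy of \<open>u\<close> itself lies at
  distance two, through a common neighbour.
\<close>
lemma gdist_mycielskian_ge:
  assumes "u \<in> pverts G"
  shows "min (gdist G u v) 4 \<le> gdist (mycielskian G) (Orig u) (Orig v)"
    and "u \<noteq> v \<Longrightarrow> min (gdist G u v) 3 \<le> gdist (mycielskian G) (Orig u) (Copy v)"
proof -
  define f where "f = (\<lambda>x. case x of
      Orig w \<Rightarrow> min (gdist G u w) 4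
    | Copy w \<Rightarrow> if w = u then 2 else min (gdist G u w) 3
    | Root \<Rightarrow> 2)"
  have self: "gdist G u u = 0"
    using assms by (rule gdist_self)
  have "f (Orig u) = min (gdist G u u) 4"
    by (simp add: f_def)
  then have start: "f (Orig u) = 0"
    by (simp add: self min_absorb1)
  have orig_orig: "min b 4 \<le> min a 4 + 1" and orig_copy: "min b 3 \<le> min a 4 + 1"
    and copy_orig: "min b 4 \<le> min a 3 + 1"
    if "b \<le> a + 1" for a b :: ereal
    using that by (cases a; cases b; simp add: min_def one_ereal_def)+
  have one: "2 \<le> min b 3 + 1" "2 \<le> min b 4 + 1" if "1 \<le> b" for b :: ereal
    using that by (cases b; simp add: min_def one_ereal_def)+
  have "f y \<le> f x + 1" if "(x, y) \<in> parcs (mycielskian G)" for x y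
  proof (cases x; cases y)
    fix v w assume "x = Orig v" "y = Orig w"
    then show ?thesis
      using that gdist_arc_le[of v w u] orig_orig by (simp add: f_def)
  next
    fix v w assume xy: "x = Orig v" "y = Copy w"
    then have vw: "(v, w) \<in> parcs G" using that by simp
    show ?thesis
    proof (cases "w = u")
      case True
      then have "1 \<le> gdist G u v"
        using vw no_loops' by (intro one_le_gdist) auto
      then show ?thesis
        using xy True one(2) by (simp add: f_def)
    next
      case False
      then show ?thesis
        using xy gdist_arc_le[OF vw, of u] orig_copy by (simp add: f_def)
    qed
  next
    fix v w assume xy: "x = Copy v" "y = Orig w"
    then have vw: "(v, w) \<in> parcs G" using that by simp
    show ?thesis
    proof (cases "v = u")
      case True
      then have "gdist G u w \<le> 1"
        using gdist_arc_le[OF vw, of u] self by simp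
      then show ?thesis
        using xy True by (cases "gdist G u w") (auto simp: f_def min_def one_ereal_def)
    next
      case False
      then show ?thesis
        using xy gdist_arc_le[OF vw, of u] copy_orig by (simp add: f_def)
    qed
  next
    fix v assume "x = Copy v" "y = Root"
    then show ?thesis
      using one_le_gdist[of u v] one by (auto simp: f_def one_ereal_def)
  next
    fix w assume "x = Root" "y = Copy w"
    then show ?thesis
      by (auto simp: f_def one_ereal_def min_def)
  qed (use that in auto)
  then have "f x \<le> gdist (mycielskian G) (Orig u) x" for x
    using start by (rule M.potential_le_gdist)
  from this[of "Orig v"] this[of "Copy v"]
  show "min (gdist G u v) 4 \<le> gdist (mycielskian G) (Orig u) (Orig v)"
    and "u \<noteq> v \<Longrightarrow> min (gdist G u v) 3 \<le> gdist (mycielskian G) (Orig u) (Copy v)"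
    by (auto simp: f_def)
qed

lemma shortest_path_via_root_to_copy:
  assumes "(u, v) \<in> parcs G" "w \<in> pverts G" "3 \<le> gdist G u w"
  shows "shortest_path (mycielskian G) [Orig u, Copy v, Root, Copy w]"
proof (rule M.shortest_pathI)
  have vert: "u \<in> pverts G" "v \<in> pverts G"
    using assms(1) by (auto dest: in_arcsD1 in_arcsD2)
  have "gdist G u v \<le> 1"
    using gdist_arc_le[OF assms(1), of u] gdist_self[of u] vert by simp
  then have "gdist G u v < 3"
    by (rule le_less_trans) (simp add: one_ereal_def)
  with assms(3) gdist_self[OF vert(1)] have "v \<noteq> w" "u \<noteq> w"
    by (auto simp flip: not_less)
  then show "distinct [Orig u, Copy v, Root, Copy w]"
    by simp
  show "vwalk [Orig u, Copy v, Root, Copy w] (with_proj (mycielskian G))"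
    using assms vert by simp
  show "ereal (real (length [Orig u, Copy v, Root, Copy w] - 1))
      \<le> gdist (mycielskian G) (hd [Orig u, Copy v, Root, Copy w]) (last [Orig u, Copy v, Root, Copy w])"
    using gdist_mycielskian_ge(2)[OF vert(1) \<open>u \<noteq> w\<close>] assms(3) by (simp add: min_absorb2)
qed

lemma shortest_path_via_root_to_orig:
  assumes "(u, v) \<in> parcs G" "(x, w) \<in> parcs G" "4 \<le> gdist G u w"
  shows "shortest_path (mycielskian G) [Orig u, Copy v, Root, Copy x, Orig w]"
proof (rule M.shortest_pathI)
  have vert: "u \<in> pverts G" "v \<in> pverts G" "x \<in> pverts G" "w \<in> pverts G"
    using assms by (auto dest: in_arcsD1 in_arcsD2)
  have "gdist G u w < 4" if "v = x"
  proof -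
    have "gdist G u w \<le> 2"
      using gdist_le_length[of "[u, v, w]"] assms that vert by simp
    then show ?thesis
      by (rule le_less_trans) simp
  qed
  with assms(3) gdist_self[OF vert(1)] have "v \<noteq> x" "u \<noteq> w"
    by (auto simp flip: not_less)
  then show "distinct [Orig u, Copy v, Root, Copy x, Orig w]"
    by simp
  show "vwalk [Orig u, Copy v, Root, Copy x, Orig w] (with_proj (mycielskian G))"
    using assms vert by simp
  show "ereal (real (length [Orig u, Copy v, Root, Copy x, Orig w] - 1))
      \<le> gdist (mycielskian G) (hd [Orig u, Copy v, Root, Copy x, Orig w])
          (last [Orig u, Copy v, Root, Copy x, Orig w])"
    using gdist_mycielskian_ge(1)[OF vert(1), of w] assms(3) by (simp add: min_absorb2)
qed

end

text \<open>
  The set \<open>C\<close> selects the vertices of \<open>G\<close> that are represented by their copies.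
\<close>
definition mlift :: "'a set \<Rightarrow> 'a \<Rightarrow> 'a mvertex" where
  "mlift C v = (if v \<in> C then Copy v else Orig v)"

text \<open>
  Copies are pairwise non-adjacent, so the lift is a walk if no two consecutive vertices are
  selected, and the caps of \<open>gdist_mycielskian_ge\<close> are not exceeded by its length. The
  potential starts in an original vertex, so a path with one selected end is to be read from the
  other one; two selected ends are compatible with a shortest lift only on length two.
\<close>
lemma (in pair_graph) shortest_path_mlift:
  assumes "shortest_path G p"
    and indep: "\<And>v w. (v, w) \<in> set (vwalk_arcs p) \<Longrightarrow> v \<notin> C \<or> w \<notin> C"
    and hd: "hd p \<notin> C"
    and "length p \<le> 5"
    and last: "last p \<in> C \<Longrightarrow> length p \<le> 4"
  shows "shortest_path (mycielskian G) (map (mlift C) p)"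
proof -
  interpret M: pair_graph "mycielskian G"
    by (rule pair_graph_mycielskian)
  let ?q = "map (mlift C) p"
  have p: "vwalk p (with_proj G)" "distinct p" "p \<noteq> []"
    and d: "gdist G (hd p) (last p) = ereal (real (length p - 1))"
    using assms(1) by (auto simp: shortest_path_def)
  show ?thesis
  proof (rule M.shortest_pathI)
    show "vwalk ?q (with_proj (mycielskian G))"
      using p(1) indep
    proof (induction p rule: vwalk_arcs.induct)
      case (3 x y xs)
      have "vwalk (map (mlift C) (y # xs)) (with_proj (mycielskian G))"
        by (rule 3(1)) (use 3(2,3) in auto)
      moreover have "(mlift C x, mlift C y) \<in> parcs (mycielskian G)"
        using 3(2) 3(3)[of x y] by (simp add: mlift_def)
      ultimately show ?case by simp
    qed (simp_all add: vwalk_def mlift_def)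
    have "inj (mlift C)"
      by (auto simp: inj_def mlift_def split: if_splits)
    then show "distinct ?q"
      using p(2) by (simp add: distinct_map inj_on_def)
    have u: "hd p \<in> pverts G"
      using p by (auto simp: vwalk_def)
    have "hd p \<noteq> last p" if "last p \<in> C"
      using that hd by auto
    then have "ereal (real (length p - 1)) \<le> gdist (mycielskian G) (Orig (hd p)) (mlift C (last p))"
      using gdist_mycielskian_ge[OF u, of "last p"] d assms(4) last
      by (auto simp: mlift_def min_def split: if_splits)
    then show "ereal (real (length ?q - 1)) \<le> gdist (mycielskian G) (hd ?q) (last ?q)"
      using p(3) hd by (simp add: hd_map last_map mlift_def)
  qed
qed

section \<open>The partition induced by a general position set\<close>

locale rootless_general_position = pair_graph G for G :: "'a pair_pre_digraph" +
  fixes S :: "'a mvertex set"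
  assumes gp: "general_position_set (mycielskian G) S"
    and root: "Root \<notin> S"
begin

sublocale M: pair_graph "mycielskian G"
  by (rule pair_graph_mycielskian)

definition V1 where "V1 = {u \<in> pverts G. Orig u \<in> S \<and> Copy u \<in> S}"
definition V2 where "V2 = {u \<in> pverts G. Orig u \<notin> S \<and> Copy u \<in> S}"
definition V3 where "V3 = {u \<in> pverts G. Orig u \<in> S \<and> Copy u \<notin> S}"
definition V4 where "V4 = {u \<in> pverts G. Orig u \<notin> S \<and> Copy u \<notin> S}"

lemmas V_defs = V1_def V2_def V3_def V4_def

lemmas no_three = M.general_position_no_three[OF gp]

text \<open>
  Two copies are at distance two by way of the root, so two selected ends are possible on paths of
  length two, which the lifts along \<open>mlift\<close> do not cover.
\<close>
lemma no_copy_orig_copy: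
  assumes "(a, b) \<in> parcs G" "(b, c) \<in> parcs G" "a \<noteq> c"
    and "Copy a \<in> S" "Orig b \<in> S" "Copy c \<in> S"
  shows False
proof (rule no_three)
  show "shortest_path (mycielskian G) [Copy a, Orig b, Copy c]"
    by (rule M.shortest_path_induced_P3) (use assms in auto)
  show "{Copy a, Orig b, Copy c} \<subseteq> set [Copy a, Orig b, Copy c] \<inter> S"
    using assms by simp
qed (use assms in auto)

lemma no_three_on_mlift:
  assumes "shortest_path G p"
    and "\<And>v w. (v, w) \<in> set (vwalk_arcs p) \<Longrightarrow> v \<notin> C \<or> w \<notin> C"
    and "hd p \<notin> C"
    and "length p \<le> 5"
    and "last p \<in> C \<Longrightarrow> length p \<le> 4"
    and "{x, y, z} \<subseteq> set p" "x \<noteq> y" "x \<noteq> z" "y \<noteq> z"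
    and "mlift C x \<in> S" "mlift C y \<in> S" "mlift C z \<in> S"
  shows False
proof (rule no_three)
  show "shortest_path (mycielskian G) (map (mlift C) p)"
    by (rule shortest_path_mlift[OF assms(1-5)])
  show "{mlift C x, mlift C y, mlift C z} \<subseteq> set (map (mlift C) p) \<inter> S"
    using assms by auto
qed (use assms in \<open>auto simp: mlift_def split: if_splits\<close>)

lemma MGP1: "MGP1 G V1 V3"
proof -
  have "u \<notin> V1 \<and> v \<notin> V1" if "(u, v) \<in> parcs G" "u \<in> V1 \<union> V3" "v \<in> V1 \<union> V3" for u v
  proof -
    have False if "(u, v) \<in> parcs G" "u \<in> V1" "v \<in> V1 \<union> V3" for u v
    proof (rule no_three)
      show "shortest_path (mycielskian G) [Orig u, Orig v, Copy u]"
        by (rule M.shortest_path_induced_P3)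
          (use that no_loops' arcs_symmetric in auto)
      show "{Orig u, Orig v, Copy u} \<subseteq> set [Orig u, Orig v, Copy u] \<inter> S"
        using that by (auto simp: V_defs)
    qed (use that no_loops' in auto)
    with that show ?thesis
      using arcs_symmetric by blast
  qed
  then show ?thesis
    by (fastforce simp: MGP1_def)
qed

lemma MGP2:
  assumes "Digraph_Component.connected (with_proj G)"
  shows "MGP2 G V1 V2 V3"
  unfolding MGP2_def
proof (intro ballI impI conjI)
  fix u v w
  assume u: "u \<in> V1 \<union> V3" and v: "v \<in> V2" and uv: "(u, v) \<in> parcs G"
  have S: "Orig u \<in> S" "Copy v \<in> S"
    using u v by (auto simp: V_defs)
  have u_in: "u \<in> pverts G"
    using u by (auto simp: V_defs)
  {
    assume w: "w \<in> (V1 \<union> V2) - {u, v}"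
    then have w': "Copy w \<in> S" "w \<in> pverts G" "w \<noteq> u" "w \<noteq> v"
      by (auto simp: V_defs)
    have "(u, w) \<notin> parcs G"
      using no_copy_orig_copy[of w u v] S w' uv arcs_symmetric by blast
    then have ge: "2 \<le> gdist G u w"
      using two_le_gdist w' by auto
    (* Beyond distance two, the copy of w is reached from u by the detour through the copy of v. *)
    have "\<not> ereal (real 2) < gdist G u w"
    proof
      assume "ereal (real 2) < gdist G u w"
      then have "3 \<le> gdist G u w"
        using Suc_le_gdist[of 2] by simp
      with uv w' have "shortest_path (mycielskian G) [Orig u, Copy v, Root, Copy w]"
        by (intro shortest_path_via_root_to_copy)
      then show False
        by (rule no_three[of _ "Orig u" "Copy v" "Copy w"]) (use S w' in auto)
    qed
    with ge show "gdist G u w = 2"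
      by (auto intro: antisym)
  next
    assume w: "w \<in> V3 - {u}"
    then have w': "Orig w \<in> S" "w \<in> pverts G" "w \<noteq> u"
      by (auto simp: V_defs)
    (* Beyond distance three, this detour even leads to w itself. *)
    have "\<not> ereal (real 3) < gdist G u w"
    proof
      assume "ereal (real 3) < gdist G u w"
      then have far: "4 \<le> gdist G u w"
        using Suc_le_gdist[of 3] by simp
      obtain x where "(x, w) \<in> parcs G"
        using neighbour_if_connected[OF assms u_in w'(2)] w'(3) by blast
      with uv far
      have "shortest_path (mycielskian G) [Orig u, Copy v, Root, Copy x, Orig w]"
        by (intro shortest_path_via_root_to_orig)
      then show False
        by (rule no_three[of _ "Orig u" "Copy v" "Orig w"]) (use S w' in auto)
    qed
    then show "gdist G u w \<le> 3"
      by auto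
  }
qed

text \<open>
  An interior vertex can always be lifted to whichever of its two representatives is in \<open>S\<close>,
  since its neighbours on the path stay original.
\<close>
lemma no_interior_between_origs:
  assumes "shortest_path G p" "length p \<le> 5"
    and ends: "Orig (hd p) \<in> S" "Orig (last p) \<in> S"
    and x: "x \<in> set p" "x \<noteq> hd p" "x \<noteq> last p" "Orig x \<in> S \<or> Copy x \<in> S"
  shows False
  \<comment> \<open>The selected set is \<open>{x}\<close> or empty, depending on which representative of \<open>x\<close> is in \<open>S\<close>.\<close>
proof (rule no_three_on_mlift[where p = p and C = "{x} - {v. Orig v \<in> S}"
        and x = "hd p" and y = x and z = "last p"])
  have p: "p \<noteq> []" "distinct p" "set (vwalk_arcs p) \<subseteq> parcs G"
    using assms(1) by (auto simp: shortest_path_def vpath_def vwalk_def)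
  have "\<exists>y\<in>set p. y \<noteq> hd p"
    using x by auto
  then show "hd p \<noteq> last p"
    using p by (cases p) (auto split: if_splits)
  show "v \<notin> {x} - {v. Orig v \<in> S} \<or> w \<notin> {x} - {v. Orig v \<in> S}"
    if "(v, w) \<in> set (vwalk_arcs p)" for v w
    using that p no_loops' by blast
  show "{hd p, x, last p} \<subseteq> set p"
    using x p by auto
qed (use assms in \<open>auto simp: mlift_def\<close>)

text \<open>
  The path is lifted in reverse, from its original end to the copy of \<open>hd p\<close>. On lengths two and
  three this lift meets a third vertex of \<open>S\<close> at \<open>x\<close> unless \<open>x\<close> has to be copied and is adjacent
  to \<open>hd p\<close>, so that both of them lie in \<open>V2\<close>. On length four the distance to the copy is capped
  at three, and the shortest path to compare with is the detour over the root.
\<close>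
lemma MGP_form_if_mixed_ends:
  assumes sp: "shortest_path G p" and len: "length p \<le> 5"
    and hd: "hd p \<in> V2" and last: "last p \<in> V1 \<union> V3"
    and x: "x \<in> set p" "x \<noteq> hd p" "x \<noteq> last p" "x \<in> V1 \<union> V2 \<union> V3"
  shows "MGP_form V1 V2 V3 p"
proof -
  have dist: "distinct p" and walk: "vwalk p (with_proj G)" and "p \<noteq> []"
    and d: "gdist G (hd p) (last p) = ereal (real (length p - 1))"
    using sp by (auto simp: shortest_path_def)
  have rsp: "shortest_path G (rev p)"
    using sp by (rule shortest_path_rev)
  have hS: "Copy (hd p) \<in> S" and lS: "Orig (last p) \<in> S"
    using hd last by (auto simp: V_defs)
  have "3 \<le> length p"
    using x by (cases p; cases "tl p"; cases "tl (tl p)") auto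
  with len have "length p = 3 \<or> length p = 4 \<or> length p = 5"
    by linarith
  then consider a b c where "p = [a, b, c]" | a b c e where "p = [a, b, c, e]"
    | a b c e f where "p = [a, b, c, e, f]"
    by (auto simp: numeral_eq_Suc length_Suc_conv)
  then show ?thesis
  proof cases
    case (1 a b c)
    have "Orig b \<notin> S"
    proof
      assume "Orig b \<in> S"
      show False
        by (rule no_three_on_mlift[OF rsp, of "{a}" a b c])
          (use 1 dist hS lS \<open>Orig b \<in> S\<close> in \<open>auto simp: mlift_def\<close>)
    qed
    then have "b \<in> V2"
      using x 1 by (auto simp: V_defs)
    then show ?thesis
      using 1 hd by (simp add: MGP_form_def)
  next
    case (2 a b c e)
    have c: "c \<notin> V1 \<union> V2 \<union> V3"
    proof
      assume "c \<in> V1 \<union> V2 \<union> V3"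
      then have "Orig c \<in> S \<or> Copy c \<in> S"
        by (auto simp: V_defs)
      show False
        by (rule no_three_on_mlift[OF rsp, of "insert a ({c} - {v. Orig v \<in> S})" a c e])
          (use 2 dist hS lS \<open>Orig c \<in> S \<or> Copy c \<in> S\<close> in \<open>auto simp: mlift_def\<close>)
    qed
    have "Orig b \<notin> S"
    proof
      assume "Orig b \<in> S"
      show False
        by (rule no_three_on_mlift[OF rsp, of "{a}" a b e])
          (use 2 dist hS lS \<open>Orig b \<in> S\<close> in \<open>auto simp: mlift_def\<close>)
    qed
    then have "b \<in> V2"
      using x 2 c by (auto simp: V_defs)
    then show ?thesis
      using 2 hd last c by (simp add: MGP_form_def)
  next
    case (3 a b c e f)
    have "e \<notin> V1 \<union> V2"
    proof
      assume "e \<in> V1 \<union> V2"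
      then have e: "Copy e \<in> S"
        by (auto simp: V_defs)
      have "gdist G f a = 4" "(f, e) \<in> parcs G" "a \<in> pverts G"
        using 3 d walk gdist_sym[of a f] by (auto intro: arcs_symmetric dest: in_arcsD1)
      then have "shortest_path (mycielskian G) [Orig f, Copy e, Root, Copy a]"
        by (intro shortest_path_via_root_to_copy) auto
      then show False
        by (rule no_three[of _ "Orig f" "Copy e" "Copy a"]) (use 3 dist hS lS e in auto)
    qed
    then show ?thesis
      using 3 hd last by (simp add: MGP_form_def)
  qed
qed

lemma MGP_form_if_short_copy_ends:
  assumes "shortest_path G p" "length p \<le> 3"
    and hd: "hd p \<in> V2" and last: "last p \<in> V2"
    and x: "x \<in> set p" "x \<noteq> hd p" "x \<noteq> last p" "x \<in> V1 \<union> V2 \<union> V3"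
  shows "MGP_form V1 V2 V3 p"
proof -
  have p: "distinct p" "vwalk p (with_proj G)"
    using assms(1) by (auto simp: shortest_path_def)
  obtain a c where ac: "p = [a, x, c]"
    using assms(2) x by (cases p; cases "tl p"; cases "tl (tl p)") auto
  have "Orig x \<notin> S"
    using no_copy_orig_copy[of a x c] ac p hd last by (auto simp: V_defs)
  then have "x \<in> V2"
    using x by (auto simp: V_defs)
  then show ?thesis
    using ac hd by (simp add: MGP_form_def)
qed

lemma MGP3: "MGP3 G V1 V2 V3"
  unfolding MGP3_def
proof (intro allI impI)
  let ?A = "V1 \<union> V2 \<union> V3"
  fix p
  assume "shortest_path G p \<and> vwalk_length p \<le> 4 \<and> hd p \<in> ?A \<and> last p \<in> ?A
    \<and> 3 \<le> card (set p \<inter> ?A)"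
  then have sp: "shortest_path G p" and len: "length p \<le> 5" and ends: "hd p \<in> ?A" "last p \<in> ?A"
    and three: "3 \<le> card (set p \<inter> ?A)"
    by auto
  \<comment> \<open>Only two of the three counted vertices can be ends of the path.\<close>
  have "\<exists>x\<in>set p \<inter> ?A. x \<noteq> hd p \<and> x \<noteq> last p"
  proof (rule ccontr)
    assume "\<not> ?thesis"
    then have "set p \<inter> ?A \<subseteq> {hd p, last p}" by auto
    then have "card (set p \<inter> ?A) \<le> card {hd p, last p}"
      by (intro card_mono) auto
    also have "\<dots> \<le> 2"
      by (simp add: card_insert_if)
    finally show False using three by simp
  qed
  then obtain x where x: "x \<in> set p" "x \<noteq> hd p" "x \<noteq> last p" "x \<in> ?A"
    by auto
  have "p \<noteq> []"
    using x by auto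
  consider "hd p \<in> V2" "last p \<in> V2" | "hd p \<in> V2" "last p \<in> V1 \<union> V3"
    | "hd p \<in> V1 \<union> V3" "last p \<in> V2" | "hd p \<in> V1 \<union> V3" "last p \<in> V1 \<union> V3"
    using ends by blast
  then show "hd p \<in> V2 \<and> last p \<in> V2 \<and> 3 \<le> vwalk_length p \<or>
      MGP_form V1 V2 V3 p \<or> MGP_form V1 V2 V3 (rev p)"
  proof cases
    case 1
    then show ?thesis
      using MGP_form_if_short_copy_ends[OF sp _ _ _ x] by (cases "length p \<le> 3") auto
  next
    case 2
    then show ?thesis
      using MGP_form_if_mixed_ends[OF sp len _ _ x] by blast
  next
    case 3
    then have "MGP_form V1 V2 V3 (rev p)"
      using len x \<open>p \<noteq> []\<close>
      by (intro MGP_form_if_mixed_ends[OF shortest_path_rev[OF sp], where x = x])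
        (auto simp: hd_rev last_rev)
    then show ?thesis by blast
  next
    case 4
    then show ?thesis
      using no_interior_between_origs[OF sp len _ _ x(1-3)] x(4) by (auto simp: V_defs)
  qed
qed

theorem MGP_partition:
  assumes "Digraph_Component.connected (with_proj G)"
  shows "MGP_partition G V1 V2 V3 V4"
  unfolding MGP_partition_def using MGP1 MGP2[OF assms] MGP3 by (auto simp: V_defs)

end

theorem lemma7:
  fixes G :: "'a pair_pre_digraph" and S :: "'a mvertex set"
  assumes "pair_graph G"
    and "Digraph_Component.connected (with_proj G)"
    and "general_position_set (mycielskian G) S"
    and "Root \<notin> S"
  shows "MGP_partition G
           {u \<in> pverts G. Orig u \<in> S \<and> Copy u \<in> S}
           {u \<in> pverts G. Orig u \<notin> S \<and> Copy u \<in> S}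
           {u \<in> pverts G. Orig u \<in> S \<and> Copy u \<notin> S}
           {u \<in> pverts G. Orig u \<notin> S \<and> Copy u \<notin> S}"
proof -
  interpret pair_graph G by (rule assms(1))
  interpret rootless_general_position G S
    by unfold_locales (use assms in auto)
  show ?thesis
    using MGP_partition[OF assms(2)] unfolding V_defs .
qed

end
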